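(* Let $\mathcal{D}$ be a deformation space of $G$-trees, let $\mathcal{A}$ be a family of subgroups of $G$ stable under conjugation and under passing to subgroups, and let $\mathcal{D}_{\mathcal{A}}$ be the associated restricted deformation space. All trees in $\mathcal{D}_{\mathcal{A}}$ have the same vertex stabilizers not in $\mathcal{A}$: for any $T,T'\in\mathcal{D}_{\mathcal{A}}$, a subgroup $H\subset G$ with $H\notin\mathcal{A}$ is a vertex stabilizer of $T$ if and only if it is a vertex stabilizer of $T'$.
   Context: $G$ is a finitely generated group. A $G$-tree is a simplicial tree $T$ with an action of $G$ by simplicial automorphisms without inversions, always assumed minimal (no proper $G$-invariant subtree). A subgroup of $G$ is elliptic in $T$ if it fixes a point of $T$. A deformation space $\mathcal{D}$ is the set of all $G$-trees having the same elliptic subgroups as a given $G$-tree. The restricted deformation space $\mathcal{D}_{\mathcal{A}}$ is the set of $T\in\mathcal{D}$ all of whose edge stabilizers belong to $\mathcal{A}$. *)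

theory Defs
  imports
    Complex_Main
    "HOL-Algebra.Group_Action"
    "HOL-Algebra.Generated_Groups"
    "Graph_Theory.Pair_Digraph"
    "Graph_Theory.Digraph_Component"
begin

text \<open>
  A simplicial graph is a symmetric digraph without loops or parallel arcs (and possibly
  infinite): an unoriented edge \<open>{u, v}\<close> is the pair of arcs \<open>(u, v)\<close>, \<open>(v, u)\<close>.
  The \<open>tree\<close> predicate of the graph library only excludes directed cycles; a symmetric digraph
  has the directed cycle \<open>u, v, u\<close> along every edge, so a circuit of the underlying unoriented
  graph is a cycle of length at least 3. Connectedness includes being non-empty.
\<close>

definition simplicial_tree :: "'v pair_pre_digraph \<Rightarrow> bool" where
  "simplicial_tree T \<longleftrightarrow>
     pair_bidirected_digraph T \<and>
     Digraph_Component.connected (with_proj T) \<and>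
     \<not> (\<exists>p. pre_digraph.cycle (with_proj T) p \<and> 3 \<le> length p)"

record ('g, 'v) tree_action =
  tr :: "'v pair_pre_digraph"
  act :: "'g \<Rightarrow> 'v \<Rightarrow> 'v"

definition invariant_subtree ::
  "('g, 'm) monoid_scheme \<Rightarrow> ('g, 'v) tree_action \<Rightarrow> 'v pair_pre_digraph \<Rightarrow> bool" where
  "invariant_subtree G X S \<longleftrightarrow>
     subgraph (with_proj S) (with_proj (tr X)) \<and> simplicial_tree S \<and>
     (\<forall>g\<in>carrier G. \<forall>v\<in>pverts S. act X g v \<in> pverts S) \<and>
     (\<forall>g\<in>carrier G. \<forall>(u, v)\<in>parcs S. (act X g u, act X g v) \<in> parcs S)"

text \<open>
  Arcs need only be mapped to arcs: that the inverse of an element \<open>g\<close> does so as well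
  is the condition for \<open>g\<^sup>-\<^sup>1\<close>. The last two conjuncts are the absence of inversions and minimality.
\<close>

definition G_tree :: "('g, 'm) monoid_scheme \<Rightarrow> ('g, 'v) tree_action \<Rightarrow> bool" where
  "G_tree G X \<longleftrightarrow>
     simplicial_tree (tr X) \<and>
     group_action G (pverts (tr X)) (act X) \<and>
     (\<forall>g\<in>carrier G. \<forall>(u, v)\<in>parcs (tr X). (act X g u, act X g v) \<in> parcs (tr X)) \<and>
     (\<forall>g\<in>carrier G. \<forall>(u, v)\<in>parcs (tr X). \<not> (act X g u = v \<and> act X g v = u)) \<and>
     (\<forall>S. invariant_subtree G X S \<longrightarrow> S = tr X)"

text \<open>
  Points of the geometric realization, in barycentric coordinates: the support of a point is a
  vertex or the pair of end points of an edge. The action is extended affinely, i.e.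
  \<open>(g x)(v) = x (g\<^sup>-\<^sup>1 v)\<close>.
\<close>

definition tree_points :: "'v pair_pre_digraph \<Rightarrow> ('v \<Rightarrow> real) set" where
  "tree_points T =
     {x. (\<forall>v. 0 \<le> x v) \<and>
         ((\<exists>v\<in>pverts T. {w. x w \<noteq> 0} = {v}) \<or> (\<exists>(u, v)\<in>parcs T. {w. x w \<noteq> 0} = {u, v})) \<and>
         (\<Sum>w | x w \<noteq> 0. x w) = 1}"

definition point_act ::
  "('g, 'm) monoid_scheme \<Rightarrow> ('g, 'v) tree_action \<Rightarrow> 'g \<Rightarrow> ('v \<Rightarrow> real) \<Rightarrow> 'v \<Rightarrow> real" where
  "point_act G X g x = (\<lambda>v. if v \<in> pverts (tr X) then x (act X (inv\<^bsub>G\<^esub> g) v) else 0)"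

definition elliptic_subgroups ::
  "('g, 'm) monoid_scheme \<Rightarrow> ('g, 'v) tree_action \<Rightarrow> 'g set set" where
  "elliptic_subgroups G X =
     {H. subgroup H G \<and> (\<exists>x\<in>tree_points (tr X). \<forall>h\<in>H. point_act G X h x = x)}"

definition vertex_stabilizers ::
  "('g, 'm) monoid_scheme \<Rightarrow> ('g, 'v) tree_action \<Rightarrow> 'g set set" where
  "vertex_stabilizers G X = {stabilizer G (act X) v | v. v \<in> pverts (tr X)}"

text \<open>Setwise stabilizers of edges; these are pointwise stabilizers as there are no inversions.\<close>

definition edge_stabilizers ::
  "('g, 'm) monoid_scheme \<Rightarrow> ('g, 'v) tree_action \<Rightarrow> 'g set set" where
  "edge_stabilizers G X =
     {stabilizer G (\<lambda>g e. act X g ` e) {u, v} | u v. (u, v) \<in> parcs (tr X)}"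

text \<open>
  The deformation space of \<open>X0\<close>. Its members may be realized over a vertex type
  different from that of \<open>X0\<close>.
\<close>

definition deformation_space ::
  "('g, 'm) monoid_scheme \<Rightarrow> ('g, 'u) tree_action \<Rightarrow> ('g, 'v) tree_action set" where
  "deformation_space G X0 = {X. G_tree G X \<and> elliptic_subgroups G X = elliptic_subgroups G X0}"

definition restricted_deformation_space ::
  "('g, 'm) monoid_scheme \<Rightarrow> ('g, 'u) tree_action \<Rightarrow> 'g set set \<Rightarrow> ('g, 'v) tree_action set" where
  "restricted_deformation_space G X0 \<A> =
     {X \<in> deformation_space G X0. edge_stabilizers G X \<subseteq> \<A>}"

definition finitely_generated_group :: "('g, 'm) monoid_scheme \<Rightarrow> bool" where
  "finitely_generated_group G \<longleftrightarrow>
     group G \<and> (\<exists>S. finite S \<and> S \<subseteq> carrier G \<and> generate G S = carrier G)"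

definition stable_subgroup_family :: "('g, 'm) monoid_scheme \<Rightarrow> 'g set set \<Rightarrow> bool" where
  "stable_subgroup_family G \<A> \<longleftrightarrow>
     (\<forall>H\<in>\<A>. subgroup H G) \<and>
     (\<forall>H\<in>\<A>. \<forall>g\<in>carrier G. (g <#\<^bsub>G\<^esub> H) #>\<^bsub>G\<^esub> inv\<^bsub>G\<^esub> g \<in> \<A>) \<and>
     (\<forall>H\<in>\<A>. \<forall>K. subgroup K G \<and> K \<subseteq> H \<longrightarrow> K \<in> \<A>)"

end

theory Submission
  imports Defs
begin

text \<open>
  Let \<open>H\<close> be a vertex stabilizer of \<open>T\<close>, say of \<open>v\<close>, that is not in \<open>\<A>\<close>. It is elliptic in \<open>T'\<close>,
  hence contained in the stabilizer \<open>K\<close> of a vertex \<open>v'\<close> of \<open>T'\<close>, which in turn is elliptic in \<open>T\<close>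
  and fixes some vertex \<open>w\<close> of \<open>T\<close>. If \<open>w \<noteq> v\<close>, then \<open>H\<close> fixes both ends of the geodesic from \<open>v\<close>
  to \<open>w\<close>, so it fixes an edge and lies in \<open>\<A>\<close>, a contradiction. Hence \<open>w = v\<close> and \<open>H = K\<close>.
\<close>

text \<open>This supplies the simple path that is later closed up to a circuit through
  \<open>v\<close>.\<close>

lemma (in pair_wf_digraph) Restr_rtrancl_imp_apath:
  assumes "(a, b) \<in> (Restr (parcs G) (- {v}))\<^sup>*" "a \<in> pverts G" "a \<noteq> v"
  obtains p where "apath a p b" "v \<notin> set (pawalk_verts a p)"
proof -
  let ?R = "Restr (parcs G) (- {v})"
  have "\<exists>p. awalk a p b \<and> set p \<subseteq> ?R"
    using assms(1,2)
  proof (induction rule: converse_rtrancl_induct)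
    case base
    then show ?case by (intro exI[of _ "[]"]) (simp add: awalk_Nil_iff)
  next
    case (step x y)
    then obtain p where "awalk y p b" "set p \<subseteq> ?R"
      using in_arcsD2 by blast
    with step.hyps(1) show ?case
      by (intro exI[of _ "(x, y) # p"]) (simp add: awalk_Cons_iff)
  qed
  then obtain p where p: "awalk a p b" "set p \<subseteq> ?R" by blast
  let ?q = "awalk_to_apath p"
  have q: "apath a ?q b" "set ?q \<subseteq> ?R"
    using apath_awalk_to_apath[OF p(1)] awalk_to_apath_subset[OF p(1)] p(2) by auto
  have "v \<notin> set (pawalk_verts a ?q)"
  proof (cases "?q = []")
    case False
    \<comment> \<open>The vertices of a nonempty walk are the tails of its arcs and the head of its
      last arc, and no arc in \<open>?R\<close> touches \<open>v\<close>.\<close>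
    moreover have "last ?q \<in> ?R" using False q(2) last_in_set by blast
    ultimately show ?thesis using q(2) by (auto simp: awalk_verts_conv)
  qed (use assms(3) in simp)
  with q(1) show thesis by (rule that)
qed

text \<open>A path from \<open>a\<close> to \<open>b\<close> off \<open>v\<close>, closed up by the
  edges at \<open>v\<close>, would be a circuit. So distinct neighbours of \<open>v\<close> lie in
  different components of the tree minus \<open>v\<close>.\<close>

lemma simplicial_tree_neighbours_eq:
  assumes T: "simplicial_tree T"
    and arcs: "(v, a) \<in> parcs T" "(v, b) \<in> parcs T"
    and ab: "(a, b) \<in> (Restr (parcs T) (- {v}))\<^sup>*"
  shows "a = b"
proof (rule ccontr)
  assume "a \<noteq> b"
  interpret pair_bidirected_digraph T
    using T by (simp add: simplicial_tree_def)
  have "(b, v) \<in> parcs T"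
    using arcs(2) pair_sym_arcs by (auto simp: symmetric_def dest: symD)
  have "a \<noteq> v" "b \<noteq> v"
    using arcs pair_no_loops by force+
  obtain p where p: "apath a p b" "v \<notin> set (pawalk_verts a p)"
    using Restr_rtrancl_imp_apath[OF ab in_arcsD2[OF arcs(1)] \<open>a \<noteq> v\<close>] .
  let ?c = "(v, a) # p @ [(b, v)]"
  have p_walk: "awalk a p b" "distinct (pawalk_verts a p)"
    using p(1) by (auto simp: apath_def)
  have pb: "awalk a (p @ [(b, v)]) v"
  proof (rule awalk_appendI[OF p_walk(1)])
    show "awalk b [(b, v)] v"
      using \<open>(b, v) \<in> parcs T\<close> by (simp add: awalk_simps in_arcsD2)
  qed
  then have "awalk v ?c v"
    using arcs(1) by (simp del: awalk_append_iff add: awalk_Cons_iff)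
  moreover have "pawalk_verts a (p @ [(b, v)]) = pawalk_verts a p @ [v]"
    using awalk_verts_append[OF pb] by simp
  then have "distinct (tl (pawalk_verts v ?c))"
    using p(2) p_walk(2) by simp
  ultimately have "cycle ?c" by (auto simp: cycle_def)
  \<comment> \<open>A nonempty \<open>p\<close> excludes the harmless back-and-forth cycle of length
    2 along one edge.\<close>
  moreover have "p \<noteq> []" using p_walk(1) \<open>a \<noteq> b\<close> by (auto simp: awalk_Nil_iff)
  then have "3 \<le> length ?c" by (cases p) auto
  ultimately show False using T unfolding simplicial_tree_def by blast
qed

lemma simplicial_tree_reachable:
  assumes "simplicial_tree T" "v \<in> pverts T" "w \<in> pverts T"
  shows "(v, w) \<in> (parcs T)\<^sup>*"
proof -
  interpret pair_bidirected_digraph T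
    using assms(1) by (simp add: simplicial_tree_def)
  \<comment> \<open>Connectedness is defined through the symmetric closure, which adds no arcs
    here.\<close>
  have "mk_symmetric (with_proj T) = T"
    using pair_sym_arcs
    by (auto simp: mk_symmetric_def symmetric_def sym_def intro!: pair_pre_digraph.equality)
  then have "v \<rightarrow>\<^sup>*\<^bsub>with_proj T\<^esub> w"
    using assms unfolding simplicial_tree_def connected_def strongly_connected_def by simp
  then show ?thesis
    by (auto simp: reachable_def dest: rtrancl_on_rtranclI)
qed

text \<open>Cut the chain at its last visit to \<open>v\<close>: in the induction on the end point,
  a return to \<open>v\<close> discards everything before it.\<close>

lemma rtrancl_first_step:
  assumes "(v, w) \<in> R\<^sup>*" "v \<noteq> w"
  obtains a where "(v, a) \<in> R" "(a, w) \<in> (Restr R (- {v}))\<^sup>*"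
proof -
  have "v = w \<or> (\<exists>a. (v, a) \<in> R \<and> (a, w) \<in> (Restr R (- {v}))\<^sup>*)"
    using assms(1)
  proof (induction rule: rtrancl_induct)
    case (step y z)
    show ?case
    proof (cases "v = y \<or> v = z")
      case False
      with step have "(y, z) \<in> Restr R (- {v})" by auto
      with False step.IH show ?thesis by (meson rtrancl.rtrancl_into_rtrancl)
    qed (use step.hyps in auto)
  qed simp
  with assms(2) that show thesis by blast
qed

text \<open>The vertex \<open>a\<close> is the neighbour of \<open>v\<close> in the direction of
  \<open>w\<close>. For \<open>h\<close> in \<open>H\<close>, its image is a neighbour of
  \<open>v\<close> in the same component off \<open>v\<close>, that of \<open>w\<close>, so it
  equals \<open>a\<close> by uniqueness.\<close>

lemma G_tree_fixed_vertices_imp_fixed_arc: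
  assumes X: "G_tree G X" and H: "H \<subseteq> carrier G"
    and vw: "v \<in> pverts (tr X)" "w \<in> pverts (tr X)" "v \<noteq> w"
    and fixed: "\<And>h. h \<in> H \<Longrightarrow> act X h v = v" "\<And>h. h \<in> H \<Longrightarrow> act X h w = w"
  obtains a where "(v, a) \<in> parcs (tr X)" "\<And>h. h \<in> H \<Longrightarrow> act X h a = a"
proof -
  let ?E = "parcs (tr X)" and ?R = "Restr (parcs (tr X)) (- {v})"
  have T: "simplicial_tree (tr X)" and GA: "group_action G (pverts (tr X)) (act X)"
    and arcs: "\<And>g x y. g \<in> carrier G \<Longrightarrow> (x, y) \<in> ?E \<Longrightarrow> (act X g x, act X g y) \<in> ?E"
    using X unfolding G_tree_def by blast+
  interpret pair_bidirected_digraph "tr X"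
    using T by (simp add: simplicial_tree_def)
  interpret A: group_action G "pverts (tr X)" "act X" by fact
  obtain a where a: "(v, a) \<in> ?E" "(a, w) \<in> ?R\<^sup>*"
    using rtrancl_first_step[OF simplicial_tree_reachable[OF T vw(1,2)] vw(3)] .
  \<comment> \<open>Symmetry allows the chain from \<open>act X h a\<close> to \<open>w\<close> to
    be reversed and appended to the one from \<open>a\<close> to \<open>w\<close>.\<close>
  have "sym ?R"
    using pair_sym_arcs by (auto simp: symmetric_def sym_def)
  have "act X h a = a" if h: "h \<in> H" for h
  proof -
    have hG: "h \<in> carrier G" using h H by auto
    \<comment> \<open>Since \<open>h\<close> is injective and fixes \<open>v\<close>, it maps chains
      off \<open>v\<close> to chains off \<open>v\<close>.\<close>
    have ne: "act X h x \<noteq> v" if "x \<in> pverts (tr X)" "x \<noteq> v" for x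
      using A.inj_prop[OF hG] that vw(1) fixed(1)[OF h] by (metis inj_onD)
    have "(act X h x, act X h w) \<in> ?R\<^sup>*" if "(x, w) \<in> ?R\<^sup>*" for x
      using that
    proof (induction rule: converse_rtrancl_induct)
      case (step x y)
      then have "(act X h x, act X h y) \<in> ?R"
        using arcs[OF hG] ne in_arcsD1 in_arcsD2 by blast
      with step.IH show ?case by (meson converse_rtrancl_into_rtrancl)
    qed simp
    with a(2) have "(act X h a, w) \<in> ?R\<^sup>*" using fixed(2)[OF h] by metis
    then have "(a, act X h a) \<in> ?R\<^sup>*"
      using a(2) sym_rtrancl[OF \<open>sym ?R\<close>] by (meson rtrancl_trans symD)
    moreover have "(v, act X h a) \<in> ?E"
      using arcs[OF hG a(1)] fixed(1)[OF h] by simp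
    ultimately show ?thesis
      using simplicial_tree_neighbours_eq[OF T a(1)] by metis
  qed
  with a(1) that show thesis by blast
qed

text \<open>The support of a fixed point is preserved by \<open>H\<close>. If it is an edge, the
  absence of inversions forces its end points to be fixed.\<close>

lemma elliptic_fixes_vertex:
  assumes X: "G_tree G X" and H: "H \<in> elliptic_subgroups G X"
  obtains v where "v \<in> pverts (tr X)" "\<And>h. h \<in> H \<Longrightarrow> act X h v = v"
proof -
  have GA: "group_action G (pverts (tr X)) (act X)"
    and noinv: "\<And>g u v. g \<in> carrier G \<Longrightarrow> (u, v) \<in> parcs (tr X) \<Longrightarrow>
      \<not> (act X g u = v \<and> act X g v = u)"
    using X unfolding G_tree_def by blast+
  interpret pair_bidirected_digraph "tr X"
    using X by (simp add: G_tree_def simplicial_tree_def)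
  interpret A: group_action G "pverts (tr X)" "act X" by fact
  interpret group G using A.group_hom group_hom.axioms(1) by blast
  obtain x where sub: "subgroup H G" and x: "x \<in> tree_points (tr X)"
    and fx: "\<And>h. h \<in> H \<Longrightarrow> point_act G X h x = x"
    using H unfolding elliptic_subgroups_def by blast
  interpret H: subgroup H G by fact
  \<comment> \<open>The action on points pulls coordinates back along the inverse, so the fixed
    point equation is used for the inverse of \<open>h\<close>.\<close>
  have inv: "x (act X h v) = x v" if "h \<in> H" "v \<in> pverts (tr X)" for h v
    using fun_cong[OF fx[of "inv\<^bsub>G\<^esub> h"], of v] that by (simp add: point_act_def)
  consider (vertex) v where "v \<in> pverts (tr X)" "{w. x w \<noteq> 0} = {v}"
    | (edge) u v where "(u, v) \<in> parcs (tr X)" "{w. x w \<noteq> 0} = {u, v}"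
    using x unfolding tree_points_def by blast
  then show thesis
  proof cases
    case vertex
    have "act X h v = v" if "h \<in> H" for h
      using inv[OF that vertex(1)] vertex(2) by (metis mem_Collect_eq singleton_iff)
    with vertex(1) that show thesis by blast
  next
    case edge
    have uv: "u \<in> pverts (tr X)" "v \<in> pverts (tr X)" "u \<noteq> v"
      using edge(1) in_arcsD1 in_arcsD2 pair_no_loops by force+
    have "act X h u = u" if h: "h \<in> H" for h
    proof (rule ccontr)
      assume neq: "act X h u \<noteq> u"
      have "act X h y \<in> {u, v}" if "y \<in> {u, v}" for y
        using inv[OF h, of y] edge(2) uv that by (metis insert_iff mem_Collect_eq singletonD)
      then have "act X h u = v" "act X h v \<in> {u, v}" using neq by auto
      \<comment> \<open>By injectivity \<open>v\<close> can then only go to \<open>u\<close>, which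
        makes \<open>h\<close> an inversion.\<close>
      moreover have "act X h u \<noteq> act X h v"
        using A.inj_prop[OF H.mem_carrier[OF h]] uv by (metis inj_onD)
      ultimately show False
        using noinv[OF H.mem_carrier[OF h] edge(1)] by auto
    qed
    with uv(1) that show thesis by blast
  qed
qed

lemma vertex_stabilizer_elliptic:
  assumes "G_tree G X" and v: "v \<in> pverts (tr X)"
  shows "stabilizer G (act X) v \<in> elliptic_subgroups G X"
proof -
  interpret A: group_action G "pverts (tr X)" "act X"
    using assms(1) by (simp add: G_tree_def)
  interpret group G using A.group_hom group_hom.axioms(1) by blast
  \<comment> \<open>The vertex \<open>v\<close> itself, in barycentric coordinates.\<close>
  let ?x = "\<lambda>w. if w = v then 1 else 0 :: real"
  have supp: "{w. ?x w \<noteq> 0} = {v}" by auto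
  then have "?x \<in> tree_points (tr X)"
    using v by (auto simp: tree_points_def)
  moreover have "point_act G X h ?x = ?x" if "h \<in> stabilizer G (act X) v" for h
  proof
    fix w
    have h: "h \<in> carrier G" "act X h v = v"
      using that by (auto simp: stabilizer_def)
    show "point_act G X h ?x w = ?x w"
      \<comment> \<open>The inverse of \<open>h\<close> fixes \<open>v\<close> and, by the second
        instance, sends no other vertex to \<open>v\<close>.\<close>
      using A.orbit_sym_aux[OF h(1) v h(2)] A.orbit_sym_aux[of "inv\<^bsub>G\<^esub> h" w v] h v
      by (auto simp: point_act_def)
  qed
  ultimately show ?thesis
    using A.stabilizer_subgroup[OF v] by (auto simp: elliptic_subgroups_def)
qed

lemma vertex_stabilizer_transfer:
  assumes \<A>: "stable_subgroup_family G \<A>" and "H \<notin> \<A>"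
    and X: "G_tree G X" and Y: "G_tree G Y"
    and ell: "elliptic_subgroups G X = elliptic_subgroups G Y"
    and edges: "edge_stabilizers G X \<subseteq> \<A>"
    and H: "H \<in> vertex_stabilizers G X"
  shows "H \<in> vertex_stabilizers G Y"
proof -
  obtain v where v: "v \<in> pverts (tr X)" and Hv: "H = stabilizer G (act X) v"
    using H by (auto simp: vertex_stabilizers_def)
  have Hell: "H \<in> elliptic_subgroups G X"
    using vertex_stabilizer_elliptic[OF X v] Hv by simp
  then have sub: "subgroup H G" by (simp add: elliptic_subgroups_def)
  obtain v' where v': "v' \<in> pverts (tr Y)" "\<And>h. h \<in> H \<Longrightarrow> act Y h v' = v'"
    using elliptic_fixes_vertex[OF Y] Hell ell by metis
  define K where "K = stabilizer G (act Y) v'"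
  have HK: "H \<subseteq> K"
    using v'(2) subgroup.subset[OF sub] by (auto simp: K_def stabilizer_def)
  obtain w where w: "w \<in> pverts (tr X)" "\<And>k. k \<in> K \<Longrightarrow> act X k w = w"
    using elliptic_fixes_vertex[OF X] vertex_stabilizer_elliptic[OF Y v'(1)] ell K_def by metis
  have "w = v"
  proof (rule ccontr)
    assume "w \<noteq> v"
    then obtain a where a: "(v, a) \<in> parcs (tr X)" "\<And>h. h \<in> H \<Longrightarrow> act X h a = a"
      using G_tree_fixed_vertices_imp_fixed_arc[OF X subgroup.subset[OF sub] v w(1)] w(2) HK Hv
      by (auto simp: stabilizer_def)
    let ?S = "stabilizer G (\<lambda>g e. act X g ` e) {v, a}"
    have "?S \<in> \<A>" using a(1) edges by (auto simp: edge_stabilizers_def)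
    \<comment> \<open>Fixing both end points is enough to lie in the setwise stabilizer; closure of
      \<open>\<A>\<close> under subgroups then puts \<open>H\<close> into
      \<open>\<A>\<close>.\<close>
    moreover have "H \<subseteq> ?S" using a(2) Hv by (auto simp: stabilizer_def)
    ultimately show False
      using \<A> sub \<open>H \<notin> \<A>\<close> unfolding stable_subgroup_family_def by blast
  qed
  \<comment> \<open>Now \<open>K\<close> fixes \<open>v\<close>, whose full stabilizer is
    \<open>H\<close>.\<close>
  then have "K \<subseteq> H" using w(2) by (auto simp: Hv K_def stabilizer_def)
  with HK v'(1) show ?thesis by (auto simp: K_def vertex_stabilizers_def)
qed

theorem corollary4p5:
  fixes G :: "('g, 'm) monoid_scheme"
    and T\<^sub>0 :: "('g, 'u) tree_action"
    and T :: "('g, 'v) tree_action"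
    and T' :: "('g, 'w) tree_action"
    and \<A> :: "'g set set"
    and H :: "'g set"
  assumes "finitely_generated_group G"
    and "G_tree G T\<^sub>0"
    and "stable_subgroup_family G \<A>"
    and "T \<in> restricted_deformation_space G T\<^sub>0 \<A>"
    and "T' \<in> restricted_deformation_space G T\<^sub>0 \<A>"
    and "subgroup H G"
    and "H \<notin> \<A>"
  shows "H \<in> vertex_stabilizers G T \<longleftrightarrow> H \<in> vertex_stabilizers G T'"
  using assms(4,5) vertex_stabilizer_transfer[OF assms(3,7), of T T']
    vertex_stabilizer_transfer[OF assms(3,7), of T' T]
  unfolding restricted_deformation_space_def deformation_space_def by auto

end
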